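(* There exists a planar graph $G$ on $n$ vertices that does not admit any $\frac{\sqrt{n}}{2}$-partition of degree $5$.
   Context: For a partition $\{V_1,\dots,V_t\}$ of the vertex set $V$ of a graph $G$ into $t$ parts (ordered by index) let $G_i=G[\bigcup_{j\ge i}V_j]$ for every $i\le t$. It is a $t$-partition of degree $\ell$ of $G$ if, for every $i\le t$, every vertex $v\in V_i$ has degree at most $\ell$ in $G_i$. A $\frac{\sqrt{n}}{2}$-partition of degree $5$ is the case $t=\frac{\sqrt{n}}{2}$, $\ell=5$.
   Formalization: The formal statement takes every n at least 7 (for n = 4 the claim fails, as one part of degree at most 3 suffices) and rounds the number of parts √n/2 down to an integer when it is not one. *)

theory Defs
  imports "HOL-Analysis.Analysis" "Graph_Theory.Digraph_Component" "Graph_Theory.Pair_Digraph"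
begin

text \<open>
  Simple graphs are the symmetric loop-free digraphs of the locale \<^locale>\<open>pair_graph\<close>: an undirected
  edge \<open>uv\<close> is the pair of arcs \<open>(u, v)\<close> and \<open>(v, u)\<close>, so the degree of a vertex is its
  \<^const>\<open>out_degree\<close>.

  In a drawing, \<open>p\<close> places the vertices and \<open>\<gamma>\<close> the edges; \<open>\<gamma>\<close> is indexed by the unordered pair of
  endpoints, so the two arcs of an edge share one curve.
\<close>

definition plane_drawing ::
    "'a pair_pre_digraph \<Rightarrow> ('a \<Rightarrow> complex) \<Rightarrow> ('a set \<Rightarrow> real \<Rightarrow> complex) \<Rightarrow> bool" where
  "plane_drawing G p \<gamma> \<longleftrightarrow>
     inj_on p (pverts G) \<and>
     (\<forall>(u, v) \<in> parcs G.
        arc (\<gamma> {u, v}) \<and>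
        {pathstart (\<gamma> {u, v}), pathfinish (\<gamma> {u, v})} = {p u, p v} \<and>
        path_image (\<gamma> {u, v}) \<inter> p ` pverts G = {p u, p v}) \<and>
     (\<forall>(u, v) \<in> parcs G. \<forall>(x, y) \<in> parcs G. {u, v} \<noteq> {x, y} \<longrightarrow>
        path_image (\<gamma> {u, v}) \<inter> path_image (\<gamma> {x, y}) \<subseteq> p ` pverts G)"

definition planar :: "'a pair_pre_digraph \<Rightarrow> bool" where
  "planar G \<longleftrightarrow> (\<exists>p \<gamma>. plane_drawing G p \<gamma>)"

text \<open>
  \<open>P 1, \<dots>, P t\<close> are the parts in order; values of \<open>P\<close> outside \<open>{1..t}\<close> are irrelevant. Since
  \<^const>\<open>partition_on\<close> speaks about the set of parts, injectivity is needed to have exactly \<open>t\<close> of them,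
  pairwise disjoint.
\<close>

definition degree_partition ::
    "'a pair_pre_digraph \<Rightarrow> nat \<Rightarrow> nat \<Rightarrow> (nat \<Rightarrow> 'a set) \<Rightarrow> bool" where
  "degree_partition G t l P \<longleftrightarrow>
     partition_on (pverts G) (P ` {1..t}) \<and> inj_on P {1..t} \<and>
     (\<forall>i \<in> {1..t}. \<forall>v \<in> P i. out_degree (with_proj G \<restriction> (\<Union>j \<in> {i..t}. P j)) v \<le> l)"

end

theory Submission
  imports Defs
begin

text \<open>
  The witness is the cube of a path: the vertices are \<open>0, \<dots>, n - 1\<close>, and two of them are adjacent
  when they differ by at most \<open>3\<close>.

  Every vertex at distance at least \<open>3\<close> from both ends has degree \<open>6\<close>, so the first part of a
  partition of degree \<open>5\<close> can only contain the first three and the last three vertices. What is left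
  contains the cube of a path on \<open>n - 6\<close> vertices, and the argument repeats: the parts \<open>1, \<dots>, t\<close>
  together miss every \<open>v\<close> with \<open>3 * t \<le> v\<close> and \<open>v + 3 * t < n\<close> (\<open>part_avoids_middle\<close>). Such a \<open>v\<close>
  exists once \<open>n > 6 * t\<close>. For \<open>t \<ge> 2\<close> this follows from \<open>n \<ge> 4 * t\<^sup>2\<close>, and for \<open>t = 1\<close> it is
  the hypothesis \<open>n \<ge> 7\<close>.

  The graph is planar because it is obtained from a triangle by repeatedly placing a new vertex
  inside the triangle of the last three vertices and joining it to its corners. If the new vertex is
  always the centroid, a single affine map \<open>step\<close> sends each vertex to the next one, so the drawing
  is the orbit of one picture: the triangle of the vertices \<open>0\<close>, \<open>1\<close>, \<open>2\<close>, and the three segments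
  from vertex \<open>0\<close> to the vertices \<open>1\<close>, \<open>2\<close>, \<open>3\<close>, which touch the triangle of these last three only
  there (\<open>spoke_Int_step_triangle\<close>). This excludes all crossings: an edge whose smaller end is \<open>k\<close>
  lies in the \<open>k\<close>-th triangle, everything drawn from later vertices lies in the next one, and two
  edges with the same smaller end meet only there.
\<close>

section \<open>The cube of a path\<close>

definition path_cube :: "nat \<Rightarrow> nat pair_pre_digraph" where
  "path_cube n = \<lparr> pverts = {..<n},
     parcs = {(u, v). u < n \<and> v < n \<and> u \<noteq> v \<and> u \<le> v + 3 \<and> v \<le> u + 3} \<rparr>"

lemma pair_graph_path_cube: "pair_graph (path_cube n)"
proof -
  have "parcs (path_cube n) \<subseteq> {..<n} \<times> {..<n}"
    by (auto simp: path_cube_def)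
  then have "finite (parcs (path_cube n))"
    by (rule finite_subset) simp
  then show ?thesis
    by unfold_locales (auto simp: path_cube_def symmetric_def intro!: symI)
qed

lemma path_cube_out_degree_ge_6:
  assumes "3 \<le> v" "v + 3 < n" "{v - 3..v + 3} \<subseteq> W"
  shows "6 \<le> out_degree (with_proj (path_cube n) \<restriction> W) v"
proof -
  let ?N = "{v - 3..v + 3} - {v}"
  let ?A = "out_arcs (with_proj (path_cube n) \<restriction> W) v"
  have "v \<in> W"
    using assms by auto
  then have "Pair v ` ?N \<subseteq> ?A"
    using assms by (auto simp: out_arcs_def induce_subgraph_def path_cube_def)
  moreover have "?A \<subseteq> {..<n} \<times> {..<n}"
    by (auto simp: out_arcs_def induce_subgraph_def path_cube_def)
  then have "finite ?A"
    by (rule finite_subset) simp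
  ultimately have "card (Pair v ` ?N) \<le> card ?A"
    by (intro card_mono)
  moreover have "card (Pair v ` ?N) = card ?N"
    by (intro card_image) (auto simp: inj_on_def)
  moreover have "card ?N = 6"
    using assms by (simp add: card_Diff_singleton)
  ultimately show ?thesis
    by (simp add: out_degree_def)
qed

text \<open>
  By induction the parts before part \<open>i\<close> miss the vertices at distance at least \<open>3 * (i - 1)\<close> from
  the ends; these vertices therefore lie in the \<open>i\<close>-th subgraph, where those that are \<open>3\<close> steps
  further inside have all their \<open>6\<close> neighbours.
\<close>

lemma part_avoids_middle:
  assumes P: "degree_partition (path_cube n) t 5 P" and "1 \<le> i" "i \<le> t" "v \<in> P i"
  shows "\<not> (3 * i \<le> v \<and> v + 3 * i < n)"
  using assms(2-)
proof (induction i arbitrary: v rule: less_induct)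
  case (less i)
  let ?W = "\<Union>j\<in>{i..t}. P j"
  have parts: "{..<n} = (\<Union>j\<in>{1..t}. P j)"
    using P unfolding degree_partition_def partition_on_def path_cube_def by simp
  show ?case
  proof
    assume v: "3 * i \<le> v \<and> v + 3 * i < n"
    have "{v - 3..v + 3} \<subseteq> ?W"
    proof
      fix w assume w: "w \<in> {v - 3..v + 3}"
      then have "w < n"
        using v \<open>1 \<le> i\<close> by auto
      then have "w \<in> (\<Union>j\<in>{1..t}. P j)"
        unfolding parts[symmetric] by simp
      then obtain j where j: "1 \<le> j" "j \<le> t" "w \<in> P j"
        by auto
      have "\<not> j < i"
      proof
        assume "j < i"
        then have "3 * j + 3 \<le> 3 * i"
          by simp
        then have "3 * j \<le> w \<and> w + 3 * j < n"
          using w v by auto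
        then show False
          using less.IH[OF \<open>j < i\<close> j] by simp
      qed
      then show "w \<in> ?W"
        using j by auto
    qed
    then have "6 \<le> out_degree (with_proj (path_cube n) \<restriction> ?W) v"
      using v \<open>1 \<le> i\<close> by (intro path_cube_out_degree_ge_6) auto
    moreover have "out_degree (with_proj (path_cube n) \<restriction> ?W) v \<le> 5"
      using P less.prems unfolding degree_partition_def by auto
    ultimately show False
      by simp
  qed
qed

lemma path_cube_no_degree_partition:
  assumes "6 * t < n"
  shows "\<not> degree_partition (path_cube n) t 5 P"
proof
  assume P: "degree_partition (path_cube n) t 5 P"
  have "3 * t \<in> (\<Union>j\<in>{1..t}. P j)"
    using P assms unfolding degree_partition_def partition_on_def path_cube_def by auto
  then obtain j where "1 \<le> j" "j \<le> t" "3 * t \<in> P j"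
    by auto
  from part_avoids_middle[OF P this] show False
    using assms \<open>j \<le> t\<close> by auto
qed

section \<open>A self-similar drawing\<close>

text \<open>
  The vertices are placed along the orbit of \<open>0\<close> under the affine map that sends \<open>0\<close>, \<open>1\<close>, \<open>\<i>\<close> to
  \<open>1\<close>, \<open>\<i>\<close> and the centroid of these three points.
\<close>

definition step :: "complex \<Rightarrow> complex" where
  "step z = Complex (1 - Re z - 2 / 3 * Im z) (Re z + Im z / 3)"

definition position :: "nat \<Rightarrow> complex" where
  "position k = (step ^^ k) 0"

definition triangle :: "complex set" where
  "triangle = {z. 0 \<le> Re z \<and> 0 \<le> Im z \<and> Re z + Im z \<le> 1}"

lemma inj_step: "inj step"
  by (rule injI) (simp add: step_def complex_eq_iff)

lemma inj_step_funpow: "inj (step ^^ k)"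
  using inj_step by (rule inj_fn)

lemma step_image_closed_segment: "step ` closed_segment a b = closed_segment (step a) (step b)"
proof -
  have "step ((1 - u) *\<^sub>R a + u *\<^sub>R b) = (1 - u) *\<^sub>R step a + u *\<^sub>R step b" for u
    by (simp add: step_def complex_eq_iff algebra_simps add_divide_distrib diff_divide_distrib)
  then show ?thesis
    unfolding closed_segment_image_interval image_image by simp
qed

lemma step_funpow_image_closed_segment:
  "(step ^^ k) ` closed_segment a b = closed_segment ((step ^^ k) a) ((step ^^ k) b)"
proof (induction k)
  case (Suc k)
  have "(step ^^ Suc k) ` closed_segment a b = step ` (step ^^ k) ` closed_segment a b"
    by (simp add: image_comp)
  then show ?case
    by (simp add: Suc.IH step_image_closed_segment)
qed simp

lemma position_add: "position (k + j) = (step ^^ k) (position j)"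
  by (simp add: position_def funpow_add)

lemma closed_segment_position:
  "closed_segment (position k) (position (k + j)) = (step ^^ k) ` closed_segment 0 (position j)"
  by (simp add: step_funpow_image_closed_segment position_add) (simp add: position_def)

lemma step_triangle_subset: "step ` triangle \<subseteq> triangle"
  by (auto simp: step_def triangle_def)

lemma step_funpow_triangle_antimono:
  assumes "k \<le> m"
  shows "(step ^^ m) ` triangle \<subseteq> (step ^^ k) ` triangle"
  using assms
proof (induction m rule: dec_induct)
  case (step m)
  have "(step ^^ Suc m) ` triangle = (step ^^ m) ` step ` triangle"
    by (simp add: image_image funpow_swap1)
  also have "\<dots> \<subseteq> (step ^^ m) ` triangle"
    using step_triangle_subset by (rule image_mono)
  finally show ?case
    using step.IH by simp
qed simp

lemma position_in_triangle:
  assumes "k \<le> m"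
  shows "position m \<in> (step ^^ k) ` triangle"
proof -
  have "position m \<in> (step ^^ m) ` triangle"
    by (simp add: position_def triangle_def)
  then show ?thesis
    using step_funpow_triangle_antimono[OF assms] by auto
qed

text \<open>
  The vertices are distinct, and avoid later edges, because each triangle leaves out the oldest corner
  of the one before it.
\<close>

lemma position_notin_later_triangle: "position k \<notin> (step ^^ Suc k) ` triangle"
proof -
  have "0 \<notin> step ` triangle"
    by (auto simp: step_def triangle_def complex_eq_iff)
  then have "(step ^^ k) 0 \<notin> (step ^^ k) ` step ` triangle"
    using inj_image_mem_iff[OF inj_step_funpow] by blast
  then show ?thesis
    by (simp add: position_def image_image funpow_swap1)
qed

lemma position_eq_iff: "position k = position m \<longleftrightarrow> k = m"
proof -
  have "position k \<noteq> position m" if "k < m" for k m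
    using position_notin_later_triangle[of k] position_in_triangle[of "Suc k" m] that by auto
  then show ?thesis
    by (metis linorder_neqE_nat)
qed

lemma position_small:
  "position (Suc 0) = 1" "position 2 = \<i>" "position 3 = Complex (1/3) (1/3)"
  by (simp_all add: position_def step_def numeral_2_eq_2 numeral_3_eq_3 complex_eq_iff)

section \<open>Planarity\<close>

text \<open>
  The spokes are two sides of the triangle and the segment from their common corner to the centroid.
  Their outer ends are the corners of the next triangle, which lies on the far side of the two short
  sides that it has at the centroid.
\<close>

lemma spoke_Int_step_triangle:
  assumes "1 \<le> j" "j \<le> 3"
  shows "closed_segment 0 (position j) \<inter> step ` triangle \<subseteq> {position j}"
proof
  fix z assume "z \<in> closed_segment 0 (position j) \<inter> step ` triangle"
  then obtain u x where u: "0 \<le> u" "u \<le> 1" "z = u *\<^sub>R position j"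
    and x: "0 \<le> Re x" "0 \<le> Im x" "Re x + Im x \<le> 1" "z = step x"
    by (auto simp: in_segment triangle_def)
  have "j = Suc 0 \<or> j = 2 \<or> j = 3"
    using assms by linarith
  then have "u = 1"
    using u x by (elim disjE) (auto simp: position_small step_def complex_eq_iff)
  then show "z \<in> {position j}"
    using u by simp
qed

lemma spoke_Int_spoke:
  assumes "1 \<le> i" "i \<le> 3" "1 \<le> j" "j \<le> 3" "i \<noteq> j"
  shows "closed_segment 0 (position i) \<inter> closed_segment 0 (position j) \<subseteq> {0}"
proof
  fix z assume "z \<in> closed_segment 0 (position i) \<inter> closed_segment 0 (position j)"
  then have "\<exists>u. z = u *\<^sub>R position i" "\<exists>w. z = w *\<^sub>R position j"
    by (auto simp: in_segment)
  then obtain u w where "z = u *\<^sub>R position i" "z = w *\<^sub>R position j"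
    by blast
  moreover have "i = Suc 0 \<or> i = 2 \<or> i = 3" "j = Suc 0 \<or> j = 2 \<or> j = 3"
    using assms by linarith+
  ultimately show "z \<in> {0}"
    using \<open>i \<noteq> j\<close> by (elim disjE) (auto simp: position_small complex_eq_iff)
qed

lemma spoke_subset_triangle:
  assumes "1 \<le> j" "j \<le> 3"
  shows "closed_segment 0 (position j) \<subseteq> triangle"
proof -
  have "j = Suc 0 \<or> j = 2 \<or> j = 3"
    using assms by linarith
  then show ?thesis
    by (elim disjE) (auto simp: position_small triangle_def in_segment)
qed

lemma edge_subset_triangle:
  assumes "1 \<le> j" "j \<le> 3"
  shows "closed_segment (position k) (position (k + j)) \<subseteq> (step ^^ k) ` triangle"
  unfolding closed_segment_position using spoke_subset_triangle[OF assms] by (rule image_mono)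

text \<open>
  An injective map preserves intersections, so what holds for the spokes at \<open>0\<close> holds for the edges
  at every vertex.
\<close>

lemma edge_Int_next_triangle:
  assumes "1 \<le> j" "j \<le> 3"
  shows "closed_segment (position k) (position (k + j)) \<inter> (step ^^ Suc k) ` triangle
    \<subseteq> {position (k + j)}"
proof -
  have next_triangle: "(step ^^ Suc k) ` triangle = (step ^^ k) ` step ` triangle"
    by (simp add: image_image funpow_swap1)
  have "(step ^^ k) ` (closed_segment 0 (position j) \<inter> step ` triangle)
      \<subseteq> (step ^^ k) ` {position j}"
    using spoke_Int_step_triangle[OF assms] by (rule image_mono)
  then show ?thesis
    unfolding closed_segment_position next_triangle image_Int[OF inj_step_funpow]
    by (simp add: position_add)
qed

lemma edge_Int_edge_same_start:
  assumes "1 \<le> i" "i \<le> 3" "1 \<le> j" "j \<le> 3" "i \<noteq> j"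
  shows "closed_segment (position k) (position (k + i)) \<inter> closed_segment (position k) (position (k + j))
    \<subseteq> {position k}"
proof -
  have "(step ^^ k) ` (closed_segment 0 (position i) \<inter> closed_segment 0 (position j))
      \<subseteq> (step ^^ k) ` {0}"
    using spoke_Int_spoke[OF assms] by (rule image_mono)
  then show ?thesis
    unfolding closed_segment_position image_Int[OF inj_step_funpow]
    by (simp add: position_def)
qed

lemma edge_Int_edge_later_start:
  assumes "1 \<le> i" "i \<le> 3" "1 \<le> j" "j \<le> 3" "k < m"
  shows "closed_segment (position k) (position (k + i)) \<inter> closed_segment (position m) (position (m + j))
    \<subseteq> {position (k + i)}"
  using edge_Int_next_triangle[OF assms(1,2), of k] edge_subset_triangle[OF assms(3,4), of m]
    step_funpow_triangle_antimono[of "Suc k" m] assms(5) by (blast dest: Suc_leI)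

lemma edge_Int_positions:
  assumes "1 \<le> j" "j \<le> 3" "position i \<in> closed_segment (position k) (position (k + j))"
  shows "i = k \<or> i = k + j"
proof (cases i k rule: linorder_cases)
  case less
  then have "position i \<in> (step ^^ Suc i) ` triangle"
    using assms edge_subset_triangle[OF assms(1,2), of k] step_funpow_triangle_antimono[of "Suc i" k]
    by (blast dest: Suc_leI)
  then show ?thesis
    using position_notin_later_triangle by blast
next
  case greater
  then have "position i \<in> {position (k + j)}"
    using assms edge_Int_next_triangle[OF assms(1,2), of k] position_in_triangle[of "Suc k" i]
    by (blast dest: Suc_leI)
  then show ?thesis
    by (simp add: position_eq_iff)
qed simp

lemma path_cube_arc_cases:
  assumes "(u, v) \<in> parcs (path_cube n)"
  obtains k j where "1 \<le> j" "j \<le> 3" "k + j < n" "{u, v} = {k, k + j}"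
proof -
  have "u \<noteq> v" "u < n" "v < n" "u \<le> v + 3" "v \<le> u + 3"
    using assms by (simp_all add: path_cube_def)
  then consider "u < v" "v < n" "v \<le> u + 3" | "v < u" "u < n" "u \<le> v + 3"
    by linarith
  then show ?thesis
  proof cases
    case 1
    then show ?thesis by (intro that[of "v - u" u]) auto
  next
    case 2
    then show ?thesis by (intro that[of "u - v" v]) auto
  qed
qed

lemma planar_path_cube: "planar (path_cube n)"
proof -
  \<comment> \<open>A curve is indexed by an unordered pair, so the order of the vertices orients it.\<close>
  define \<gamma> where "\<gamma> e = linepath (position (Min e)) (position (Max e))" for e :: "nat set"
  have \<gamma>: "\<gamma> {k, k + j} = linepath (position k) (position (k + j))" for k j
    by (simp add: \<gamma>_def)
  have edge: "arc (\<gamma> {u, v}) \<and> {pathstart (\<gamma> {u, v}), pathfinish (\<gamma> {u, v})} = {position u, position v} \<and>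
      path_image (\<gamma> {u, v}) \<inter> position ` {..<n} = {position u, position v}"
    if uv: "(u, v) \<in> parcs (path_cube n)" for u v
  proof -
    obtain k j where kj: "1 \<le> j" "j \<le> 3" "k + j < n" "{u, v} = {k, k + j}"
      using uv by (rule path_cube_arc_cases)
    have ends: "{position u, position v} = {position k, position (k + j)}"
      using kj(4) by (metis image_empty image_insert)
    have "arc (linepath (position k) (position (k + j)))"
      using kj(1) by (intro arc_linepath) (simp add: position_eq_iff)
    moreover have "closed_segment (position k) (position (k + j)) \<inter> position ` {..<n}
        = {position k, position (k + j)}"
      using kj edge_Int_positions[OF kj(1,2)] by auto
    ultimately show ?thesis
      unfolding kj(4) ends \<gamma> by simp
  qed
  have crossing: "path_image (\<gamma> {u, v}) \<inter> path_image (\<gamma> {x, y}) \<subseteq> position ` {..<n}"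
    if uv: "(u, v) \<in> parcs (path_cube n)" and xy: "(x, y) \<in> parcs (path_cube n)"
      and ne: "{u, v} \<noteq> {x, y}" for u v x y
  proof -
    obtain k i where ki: "1 \<le> i" "i \<le> 3" "k + i < n" "{u, v} = {k, k + i}"
      using uv by (rule path_cube_arc_cases)
    obtain m j where mj: "1 \<le> j" "j \<le> 3" "m + j < n" "{x, y} = {m, m + j}"
      using xy by (rule path_cube_arc_cases)
    have "closed_segment (position k) (position (k + i)) \<inter> closed_segment (position m) (position (m + j))
        \<subseteq> {position k, position (k + i), position (m + j)}"
    proof (cases k m rule: linorder_cases)
      case less
      then show ?thesis
        using edge_Int_edge_later_start[OF ki(1,2) mj(1,2)] by blast
    next
      case equal
      then have "i \<noteq> j"
        using ne ki(4) mj(4) by auto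
      then show ?thesis
        using edge_Int_edge_same_start[OF ki(1,2) mj(1,2)] equal by blast
    next
      case greater
      then show ?thesis
        using edge_Int_edge_later_start[OF mj(1,2) ki(1,2)] by blast
    qed
    moreover have "{position k, position (k + i), position (m + j)} \<subseteq> position ` {..<n}"
      using ki(3) mj(3) by auto
    ultimately show ?thesis
      unfolding ki(4) mj(4) \<gamma> path_image_linepath by (rule subset_trans)
  qed
  have "plane_drawing (path_cube n) position \<gamma>"
    unfolding plane_drawing_def
  proof (intro conjI)
    show "inj_on position (pverts (path_cube n))"
      by (simp add: inj_on_def position_eq_iff)
    have pverts: "pverts (path_cube n) = {..<n}"
      by (simp add: path_cube_def)
    show "\<forall>(u, v) \<in> parcs (path_cube n). arc (\<gamma> {u, v}) \<and>
        {pathstart (\<gamma> {u, v}), pathfinish (\<gamma> {u, v})} = {position u, position v} \<and>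
        path_image (\<gamma> {u, v}) \<inter> position ` pverts (path_cube n) = {position u, position v}"
      unfolding pverts using edge by blast
    show "\<forall>(u, v) \<in> parcs (path_cube n). \<forall>(x, y) \<in> parcs (path_cube n). {u, v} \<noteq> {x, y} \<longrightarrow>
        path_image (\<gamma> {u, v}) \<inter> path_image (\<gamma> {x, y}) \<subseteq> position ` pverts (path_cube n)"
      unfolding pverts using crossing by blast
  qed
  then show ?thesis
    unfolding planar_def by blast
qed

section \<open>Comparison of the number of parts with the number of vertices\<close>

lemma six_times_half_sqrt_less:
  fixes n :: nat
  assumes "n \<ge> 7"
  shows "6 * nat \<lfloor>sqrt (real n) / 2\<rfloor> < n"
proof -
  define t where "t = nat \<lfloor>sqrt (real n) / 2\<rfloor>"
  have "real t \<le> sqrt (real n) / 2"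
    unfolding t_def by (rule of_nat_floor) simp
  then have "(2 * real t)\<^sup>2 \<le> (sqrt (real n))\<^sup>2"
    by (intro power_mono) auto
  then have "real (4 * t\<^sup>2) \<le> real n"
    by (simp add: power_mult_distrib)
  then have n: "4 * t\<^sup>2 \<le> n"
    by (simp only: of_nat_le_iff)
  show ?thesis
  proof (cases "t \<le> 1")
    case True
    then show ?thesis
      using assms unfolding t_def[symmetric] by simp
  next
    case False
    then have "2 * t \<le> t\<^sup>2"
      by (simp add: power2_eq_square)
    then show ?thesis
      using n False unfolding t_def[symmetric] by simp
  qed
qed

theorem proposition6:
  fixes n :: nat
  assumes "n \<ge> 7"
  shows "\<exists>G :: nat pair_pre_digraph. pair_graph G \<and> card (pverts G) = n \<and> planar G \<and>
           \<not> (\<exists>P. degree_partition G (nat \<lfloor>sqrt (real n) / 2\<rfloor>) 5 P)"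
proof (intro exI[of _ "path_cube n"] conjI)
  show "card (pverts (path_cube n)) = n"
    by (simp add: path_cube_def)
  show "\<not> (\<exists>P. degree_partition (path_cube n) (nat \<lfloor>sqrt (real n) / 2\<rfloor>) 5 P)"
    using path_cube_no_degree_partition[OF six_times_half_sqrt_less[OF assms]] by blast
qed (rule pair_graph_path_cube planar_path_cube)+

end
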